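(* Let $\{ (A_{\alpha}, \Phi_{\alpha}) \mid \alpha \in \Lambda\}$ be a family of $\mathcal{C}^{\infty}$-subrings of a $\mathcal{C}^{\infty}$-ring $(A,\Phi)$, so that $\Phi_{\alpha}(f) = \Phi(f)\upharpoonright_{A_{\alpha}^n}: A_{\alpha}^n \rightarrow A_{\alpha}$ for all $\alpha\in\Lambda$, $n\in\mathbb{N}$ and $f\in\mathcal{C}^{\infty}(\mathbb{R}^n,\mathbb{R})$. Then $\left( \bigcap_{\alpha \in \Lambda} A_{\alpha}, \Phi'\right)$, where for each $n \in \mathbb{N}$ and $f\in\mathcal{C}^{\infty}(\mathbb{R}^n,\mathbb{R})$ $$\Phi'(f) = \Phi(f)\upharpoonright_{\left(\bigcap_{\alpha \in \Lambda} A_{\alpha}\right)^n}: \Big( \bigcap_{\alpha \in \Lambda} A_{\alpha}\Big)^n \rightarrow \bigcap_{\alpha \in \Lambda} A_{\alpha},$$ is a $\mathcal{C}^{\infty}$-subring of $(A,\Phi)$.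
   Context: $\mathbb{N}=\{0,1,2,\dots\}$. A $\mathcal{C}^{\infty}$-structure is a pair $(A,\Phi)$, where $A$ is a set and $\Phi$ assigns to each $n\in\mathbb{N}$ and each smooth function $f\in\mathcal{C}^{\infty}(\mathbb{R}^n,\mathbb{R})$ a function $\Phi(f):A^n\to A$. It is a $\mathcal{C}^{\infty}$-ring if (1) for each $n$ and $k\le n$, the projection $p_k:\mathbb{R}^n\to\mathbb{R}$ onto the $k$-th coordinate is sent to the projection $\pi_k:A^n\to A$ onto the $k$-th coordinate; and (2) whenever $f\in\mathcal{C}^{\infty}(\mathbb{R}^n,\mathbb{R})$, $g_1,\dots,g_n,h\in\mathcal{C}^{\infty}(\mathbb{R}^k,\mathbb{R})$ and $h=f\circ(g_1,\dots,g_n)$, then $\Phi(h)=\Phi(f)\circ(\Phi(g_1),\dots,\Phi(g_n))$. For $B\subseteq A$, $(B,\Phi')$ is a $\mathcal{C}^{\infty}$-subring of $(A,\Phi)$ if for all $n\in\mathbb{N}$, $f\in\mathcal{C}^{\infty}(\mathbb{R}^n,\mathbb{R})$ and $(b_1,\dots,b_n)\in B^n$ one has $\Phi(f)(b_1,\dots,b_n)\in B$, where $\Phi'(f)=\Phi(f)\upharpoonright_{B^n}:B^n\to B$. *)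

theory Defs
  imports "HOL-Analysis.Analysis"
begin

text \<open>
  The arity \<open>n\<close> ranges over all natural numbers inside the definitions below, so \<open>n\<close>-tuples
  are extensional functions on \<open>{..<n}\<close>; coordinates are numbered from \<open>0\<close>. Functions with
  domain \<open>D\<close> are likewise extensional on \<open>D\<close>, so that equality of functions is HOL equality.
\<close>

definition tuples :: "nat \<Rightarrow> 'a set \<Rightarrow> (nat \<Rightarrow> 'a) set" where
  "tuples n A = {..<n} \<rightarrow>\<^sub>E A"

abbreviation Rn :: "nat \<Rightarrow> (nat \<Rightarrow> real) set" where
  "Rn n \<equiv> tuples n UNIV"

text \<open>
  \<open>C_times n k f\<close>: all partial derivatives of \<open>f\<close> of order at most \<open>k\<close> exist and are continuous
  on \<open>\<real>\<^sup>n\<close>. Here \<open>g i\<close> is the partial derivative of \<open>f\<close> in direction \<open>i\<close>. The topology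
  \<open>powertop_real {..<n}\<close> has \<open>Rn n\<close> as its underlying set.
\<close>

primrec C_times :: "nat \<Rightarrow> nat \<Rightarrow> ((nat \<Rightarrow> real) \<Rightarrow> real) \<Rightarrow> bool" where
  "C_times n 0 f \<longleftrightarrow> continuous_map (powertop_real {..<n}) euclideanreal f"
| "C_times n (Suc k) f \<longleftrightarrow>
     continuous_map (powertop_real {..<n}) euclideanreal f \<and>
     (\<exists>g. \<forall>i<n.
        (\<forall>x\<in>Rn n. ((\<lambda>t. f (x(i := t))) has_real_derivative g i x) (at (x i))) \<and>
        C_times n k (g i))"

definition C_infinity :: "nat \<Rightarrow> ((nat \<Rightarrow> real) \<Rightarrow> real) set" where
  "C_infinity n = {f \<in> extensional (Rn n). \<forall>k. C_times n k f}"

definition proj :: "nat \<Rightarrow> 'a set \<Rightarrow> nat \<Rightarrow> (nat \<Rightarrow> 'a) \<Rightarrow> 'a" where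
  "proj n A i = (\<lambda>x\<in>tuples n A. x i)"

text \<open>
  \<open>f \<circ> (g\<^sub>0, \<dots>, g\<^sub>n\<^sub>-\<^sub>1)\<close>, where \<open>f\<close> is \<open>n\<close>-ary and every \<open>g\<^sub>i\<close> is a \<open>k\<close>-ary function on \<open>A\<close>.
\<close>

definition tuple_comp ::
  "nat \<Rightarrow> nat \<Rightarrow> 'a set \<Rightarrow> ((nat \<Rightarrow> 'a) \<Rightarrow> 'a) \<Rightarrow> (nat \<Rightarrow> (nat \<Rightarrow> 'a) \<Rightarrow> 'a) \<Rightarrow> (nat \<Rightarrow> 'a) \<Rightarrow> 'a" where
  "tuple_comp n k A f g = (\<lambda>x\<in>tuples k A. f (\<lambda>i\<in>{..<n}. g i x))"

text \<open>
  An assignment takes the arity as an explicit argument. Its values on functions outside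
  \<open>C_infinity n\<close> are irrelevant.
\<close>

type_synonym 'a assignment =
  "nat \<Rightarrow> ((nat \<Rightarrow> real) \<Rightarrow> real) \<Rightarrow> (nat \<Rightarrow> 'a) \<Rightarrow> 'a"

definition C_infinity_structure :: "'a set \<Rightarrow> 'a assignment \<Rightarrow> bool" where
  "C_infinity_structure A \<Phi> \<longleftrightarrow> (\<forall>n. \<forall>f\<in>C_infinity n. \<Phi> n f \<in> tuples n A \<rightarrow>\<^sub>E A)"

definition C_infinity_ring :: "'a set \<Rightarrow> 'a assignment \<Rightarrow> bool" where
  "C_infinity_ring A \<Phi> \<longleftrightarrow>
     C_infinity_structure A \<Phi> \<and>
     (\<forall>n. \<forall>i<n. \<Phi> n (proj n UNIV i) = proj n A i) \<and>
     (\<forall>n k f g h.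
        f \<in> C_infinity n \<longrightarrow> (\<forall>i<n. g i \<in> C_infinity k) \<longrightarrow> h \<in> C_infinity k \<longrightarrow>
        h = tuple_comp n k UNIV f g \<longrightarrow>
        \<Phi> k h = tuple_comp n k A (\<Phi> n f) (\<lambda>i. \<Phi> k (g i)))"

definition C_infinity_subring ::
  "'a set \<Rightarrow> 'a assignment \<Rightarrow> 'a set \<Rightarrow> 'a assignment \<Rightarrow> bool" where
  "C_infinity_subring B \<Phi>' A \<Phi> \<longleftrightarrow>
     B \<subseteq> A \<and>
     (\<forall>n. \<forall>f\<in>C_infinity n. \<forall>b\<in>tuples n B. \<Phi> n f b \<in> B) \<and>
     (\<forall>n. \<forall>f\<in>C_infinity n. \<Phi>' n f = restrict (\<Phi> n f) (tuples n B))"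

text \<open>
  The intersection of a family of subsets of \<open>A\<close> is formed inside \<open>A\<close>: it is
  \<open>\<Inter>\<alpha>\<in>\<Lambda>. B \<alpha>\<close> for a nonempty family, and \<open>A\<close> for the empty one (where HOL's \<open>\<Inter>\<close> gives \<open>UNIV\<close>).
\<close>

definition Inter_in :: "'a set \<Rightarrow> 'i set \<Rightarrow> ('i \<Rightarrow> 'a set) \<Rightarrow> 'a set" where
  "Inter_in A \<Lambda> B = A \<inter> (\<Inter>\<alpha>\<in>\<Lambda>. B \<alpha>)"

end

theory Submission
  imports Defs
begin

text \<open>A tuple over the intersection is also a tuple over each \<open>B \<alpha>\<close>, by
  monotonicity of \<open>tuples\<close>. Each \<open>B \<alpha>\<close> is closed under the same
  operation \<open>\<Phi> n f\<close>, so the value lies in every \<open>B \<alpha>\<close> at once,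
  hence in the intersection.\<close>

lemma tuples_mono: "B \<subseteq> A \<Longrightarrow> tuples n B \<subseteq> tuples n A"
  unfolding tuples_def by (rule PiE_mono)

theorem proposition1:
  fixes A :: "'a set" and \<Phi> :: "'a assignment"
    and \<Lambda> :: "'i set" and B :: "'i \<Rightarrow> 'a set" and \<Psi> :: "'i \<Rightarrow> 'a assignment"
    and \<Phi>' :: "'a assignment"
  assumes "C_infinity_ring A \<Phi>"
    and "\<And>\<alpha>. \<alpha> \<in> \<Lambda> \<Longrightarrow> C_infinity_subring (B \<alpha>) (\<Psi> \<alpha>) A \<Phi>"
    and "\<And>n f. f \<in> C_infinity n \<Longrightarrow> \<Phi>' n f = restrict (\<Phi> n f) (tuples n (Inter_in A \<Lambda> B))"
  shows "C_infinity_subring (Inter_in A \<Lambda> B) \<Phi>' A \<Phi>"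
  unfolding C_infinity_subring_def
proof (intro conjI allI ballI)
  show "Inter_in A \<Lambda> B \<subseteq> A"
    by (simp add: Inter_in_def)
next
  fix n f b
  assume f: "f \<in> C_infinity n" and b: "b \<in> tuples n (Inter_in A \<Lambda> B)"
  \<comment> \<open>Membership in \<open>A\<close> comes from the operations of the ambient ring,
    not from a member of the family: \<open>\<Lambda>\<close> may be empty, and then the
    intersection is \<open>A\<close> itself.\<close>
  have "b \<in> tuples n A"
    using b tuples_mono[of "Inter_in A \<Lambda> B" A n] by (auto simp: Inter_in_def)
  then have "\<Phi> n f b \<in> A"
    using assms(1) f by (auto simp: C_infinity_ring_def C_infinity_structure_def)
  moreover have "\<Phi> n f b \<in> B \<alpha>" if "\<alpha> \<in> \<Lambda>" for \<alpha>
  proof -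
    have "b \<in> tuples n (B \<alpha>)"
      using b that tuples_mono[of "Inter_in A \<Lambda> B" "B \<alpha>" n] by (auto simp: Inter_in_def)
    then show ?thesis
      using assms(2)[OF that] f by (simp add: C_infinity_subring_def)
  qed
  ultimately show "\<Phi> n f b \<in> Inter_in A \<Lambda> B"
    by (simp add: Inter_in_def)
\<comment> \<open>The remaining clause, that \<open>\<Phi>'\<close> restricts \<open>\<Phi>\<close>,
  is how \<open>\<Phi>'\<close> was chosen; the closure just shown makes these restrictions maps
  into the intersection.\<close>
qed (rule assms(3))

end
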